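(* For all $\nu\in\mathcal{V}$ and $n,m\in\mathbb{N}$, $$p^{(\nu)}_{n+m}(x)=\sum_{k=0}^n\alpha^n_k\,\frac{\bigl(\eta^k(w_{\nu+k\sigma})\bigr)(x)}{w_\nu(x)}\,\bigl(\eta^k(p_{n-k}^{(\nu+k\sigma)})\bigr)(x)\,\bigl(T_{k,n}p^{(\nu+n\sigma)}_m\bigr)(x).$$
   Context: Setting. $\mathcal{V}$ is a (multi-parameter) set of parameters in some $\mathbb{R}^d$, and $\sigma\in\mathbb{R}^d$ is a fixed element such that $\nu\in\mathcal{V}$ implies $\nu+k\sigma\in\mathcal{V}$ for all $k\in\mathbb{N}=\{0,1,2,\dots\}$. For each $\nu\in\mathcal{V}$, $\mu^{(\nu)}$ is a positive Borel measure on $\mathbb{R}$ with infinite support and all moments finite. For each $\nu\in\mathcal V$ there is a densely defined raising operator $R_\nu: L^2(\mu^{(\nu+\sigma)})\to L^2(\mu^{(\nu)})$ mapping polynomials of degree $n$ to polynomials of degree $n+1$; its adjoint $L_\nu=(R_\nu)^*: L^2(\mu^{(\nu)})\to L^2(\mu^{(\nu+\sigma)})$ is a densely defined lowering operator, mapping polynomials of degree $n$ to polynomials of degree $n-1$ (and constants to $0$). All polynomials are in the domains of $R_\nu$ and $L_\nu$. Set $$p_n^{(\nu)}=R_\nu R_{\nu+\sigma}\cdots R_{\nu+(n-1)\sigma}\mathbf{1},$$ where $\mathbf 1$ is the constant function $1$ (so $p_0^{(\nu)}=\mathbf 1$); these are orthogonal polynomials for $\mu^{(\nu)}$. It is assumed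 that $R_\nu=M_\nu^{-1}\circ\partial\circ M_{\nu+\sigma}$, where $(M_\nu f)(x)=w_\nu(x)f(x)$ for a function $w_\nu$ with $w_\nu>0$ $\mu^{(\nu)}$-a.e., and $\partial$ is a linear operator on functions, independent of $\nu$, with the $w_\nu$ in the domain of $\partial$ (and of its powers as needed). It is assumed that there is a Leibniz rule: for all $n\in\mathbb N$ and all functions $f,g$ for which the expressions are well defined (in particular for $f=w_{\nu+n\sigma}$ and $g$ a polynomial), $$\bigl(\partial^n(fg)\bigr)(x)=\sum_{k=0}^n\alpha^n_k\,(\eta^k\partial^{n-k}f)(x)\,(T_{k,n}g)(x),$$ where $\alpha^n_k$ are constants, $\eta$ is a fixed invertible homomorphism acting on functions (so $\eta(fg)=\eta(f)\eta(g)$), and $T_{k,n}$ are fixed operators on functions. *)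

theory Defs
  imports "HOL-Analysis.Analysis" "HOL-Computational_Algebra.Polynomial"
begin

text \<open>
  Functions are concrete complex-valued functions on the real line; elements of an
  $L^2$-space are represented by such functions, up to equality almost everywhere.
\<close>

type_synonym cfun = "real \<Rightarrow> complex"

definition poly_fun :: "complex poly \<Rightarrow> cfun" where
  "poly_fun p = (\<lambda>x. poly p (complex_of_real x))"

definition mult_op :: "cfun \<Rightarrow> cfun \<Rightarrow> cfun" where
  "mult_op u f = (\<lambda>x. u x * f x)"

definition msupport :: "real measure \<Rightarrow> real set" where
  "msupport M = {x. \<forall>e>0. emeasure M (ball x e) > 0}"

definition L2 :: "real measure \<Rightarrow> cfun set" where
  "L2 M = {f \<in> borel_measurable M. integrable M (\<lambda>x. (cmod (f x))\<^sup>2)}"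

definition L2_inner :: "real measure \<Rightarrow> cfun \<Rightarrow> cfun \<Rightarrow> complex" where
  "L2_inner M f g = (LINT x|M. f x * cnj (g x))"

definition L2_dense :: "real measure \<Rightarrow> cfun set \<Rightarrow> bool" where
  "L2_dense M S \<longleftrightarrow> S \<subseteq> L2 M \<and>
     (\<forall>f\<in>L2 M. \<forall>e>0. \<exists>g\<in>S. (LINT x|M. (cmod (f x - g x))\<^sup>2) < e)"

definition lin_closed :: "cfun set \<Rightarrow> bool" where
  "lin_closed S \<longleftrightarrow> (\<lambda>x. 0) \<in> S \<and>
     (\<forall>f\<in>S. \<forall>g\<in>S. \<forall>a b. (\<lambda>x. a * f x + b * g x) \<in> S)"

text \<open>
  A densely defined linear operator from $L^2(M)$ to $L^2(N)$. The set \<open>S\<close> consists of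
  representatives of the classes in its domain; the last clause (together with
  linearity) says that the operator is well defined on classes.
\<close>

definition densely_defined_op ::
    "real measure \<Rightarrow> real measure \<Rightarrow> cfun set \<Rightarrow> (cfun \<Rightarrow> cfun) \<Rightarrow> bool" where
  "densely_defined_op M N S A \<longleftrightarrow>
     L2_dense M S \<and> lin_closed S \<and> A ` S \<subseteq> L2 N \<and>
     (\<forall>f\<in>S. \<forall>g\<in>S. \<forall>a b.
        AE x in N. A (\<lambda>x. a * f x + b * g x) x = a * A f x + b * A g x) \<and>
     (\<forall>f\<in>S. (AE x in M. f x = 0) \<longrightarrow> (AE x in N. A f x = 0))"

text \<open>
  The graph of the Hilbert space adjoint of \<open>A\<close>, with domain \<open>S\<close>, as an operator from
  $L^2(N)$ to $L^2(M)$. If \<open>S\<close> is dense then the second component is determined by the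
  first one up to equality almost everywhere.
\<close>

definition adjoint_graph ::
    "real measure \<Rightarrow> real measure \<Rightarrow> cfun set \<Rightarrow> (cfun \<Rightarrow> cfun) \<Rightarrow> (cfun \<times> cfun) set" where
  "adjoint_graph M N S A =
     {(g, h). g \<in> L2 N \<and> h \<in> L2 M \<and> (\<forall>f\<in>S. L2_inner N (A f) g = L2_inner M f h)}"

text \<open>The domain of the \<open>n\<close>-th power of a partial operator \<open>A\<close> with domain \<open>S\<close>.\<close>

definition pow_dom :: "(cfun \<Rightarrow> cfun) \<Rightarrow> cfun set \<Rightarrow> nat \<Rightarrow> cfun set" where
  "pow_dom A S n = {f. \<forall>j<n. (A ^^ j) f \<in> S}"

text \<open>All expressions in the Leibniz rule of order \<open>n\<close> for \<open>f * g\<close> are well defined.\<close>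

definition leibniz_defined ::
    "cfun set \<Rightarrow> (cfun \<Rightarrow> cfun) \<Rightarrow> cfun set \<Rightarrow> (cfun \<Rightarrow> cfun) \<Rightarrow> (nat \<Rightarrow> nat \<Rightarrow> cfun set) \<Rightarrow>
     nat \<Rightarrow> cfun \<Rightarrow> cfun \<Rightarrow> bool" where
  "leibniz_defined DD D E \<eta> TD n f g \<longleftrightarrow>
     (\<lambda>x. f x * g x) \<in> pow_dom D DD n \<and>
     (\<forall>k\<le>n. f \<in> pow_dom D DD (n - k) \<and> (D ^^ (n - k)) f \<in> pow_dom \<eta> E k \<and> g \<in> TD k n)"

text \<open>
  \<open>p_fun R \<sigma> n \<nu>\<close> is $R_\nu R_{\nu+\sigma} \cdots R_{\nu+(n-1)\sigma} \mathbf{1}$.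
\<close>

primrec p_fun :: "('v::real_vector \<Rightarrow> cfun \<Rightarrow> cfun) \<Rightarrow> 'v \<Rightarrow> nat \<Rightarrow> 'v \<Rightarrow> cfun" where
  "p_fun R \<sigma> 0 \<nu> = (\<lambda>x. 1)"
| "p_fun R \<sigma> (Suc n) \<nu> = R \<nu> (p_fun R \<sigma> n (\<nu> + \<sigma>))"

text \<open>
  \<open>RD \<nu>\<close>, \<open>DD\<close>, \<open>E\<close> and \<open>TD k n\<close> are the domains of \<open>R \<nu>\<close>, of \<open>D\<close> (the operator
  $\partial$), of \<open>\<eta>\<close> and of \<open>T k n\<close>; \<open>\<alpha> n k\<close> is $\alpha^n_k$. The map \<open>\<eta>\<close> is an
  invertible multiplicative map from \<open>E\<close> onto its range \<open>E'\<close>; in the simplest case both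
  are the set of all functions, but for a shift in the complex direction \<open>E\<close> is a proper
  set of functions with an analytic continuation.
\<close>

locale raising_operators =
  fixes V :: "(real ^ 'd) set"
    and \<sigma> :: "real ^ 'd"
    and \<mu> :: "real ^ 'd \<Rightarrow> real measure"
    and RD :: "real ^ 'd \<Rightarrow> cfun set"
    and R :: "real ^ 'd \<Rightarrow> cfun \<Rightarrow> cfun"
    and w :: "real ^ 'd \<Rightarrow> cfun"
    and DD :: "cfun set"
    and D :: "cfun \<Rightarrow> cfun"
    and E E' :: "cfun set"
    and \<eta> :: "cfun \<Rightarrow> cfun"
    and TD :: "nat \<Rightarrow> nat \<Rightarrow> cfun set"
    and T :: "nat \<Rightarrow> nat \<Rightarrow> cfun \<Rightarrow> cfun"
    and \<alpha> :: "nat \<Rightarrow> nat \<Rightarrow> complex"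
  assumes V_shift: "\<And>\<nu> k::nat. \<nu> \<in> V \<Longrightarrow> \<nu> + real k *\<^sub>R \<sigma> \<in> V"
    and borel: "\<And>\<nu>. \<nu> \<in> V \<Longrightarrow> sets (\<mu> \<nu>) = sets borel"
    and infinite_support: "\<And>\<nu>. \<nu> \<in> V \<Longrightarrow> infinite (msupport (\<mu> \<nu>))"
    and finite_moments: "\<And>\<nu> n::nat. \<nu> \<in> V \<Longrightarrow> integrable (\<mu> \<nu>) (\<lambda>x. x ^ n)"
    and R_op: "\<And>\<nu>. \<nu> \<in> V \<Longrightarrow> densely_defined_op (\<mu> (\<nu> + \<sigma>)) (\<mu> \<nu>) (RD \<nu>) (R \<nu>)"
    and poly_RD: "\<And>\<nu> p. \<nu> \<in> V \<Longrightarrow> poly_fun p \<in> RD \<nu>"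
    \<comment> \<open>For a polynomial argument, \<open>R \<nu>\<close> picks the polynomial in its \<open>L\<^sup>2\<close>-class, which is
        unique since the support is infinite.\<close>
    and R_raises: "\<And>\<nu> p. \<nu> \<in> V \<Longrightarrow> p \<noteq> 0 \<Longrightarrow>
          \<exists>q. degree q = degree p + 1 \<and> R \<nu> (poly_fun p) = poly_fun q"
    and L_densely_defined: "\<And>\<nu>. \<nu> \<in> V \<Longrightarrow>
          L2_dense (\<mu> \<nu>) (Domain (adjoint_graph (\<mu> (\<nu> + \<sigma>)) (\<mu> \<nu>) (RD \<nu>) (R \<nu>)))"
    and L_lowers: "\<And>\<nu> p. \<nu> \<in> V \<Longrightarrow> degree p \<ge> 1 \<Longrightarrow>
          \<exists>q. q \<noteq> 0 \<and> degree q = degree p - 1 \<and>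
            (poly_fun p, poly_fun q) \<in> adjoint_graph (\<mu> (\<nu> + \<sigma>)) (\<mu> \<nu>) (RD \<nu>) (R \<nu>)"
    and L_const: "\<And>\<nu> c. \<nu> \<in> V \<Longrightarrow>
          (\<lambda>x. c, \<lambda>x. 0) \<in> adjoint_graph (\<mu> (\<nu> + \<sigma>)) (\<mu> \<nu>) (RD \<nu>) (R \<nu>)"
    and w_pos: "\<And>\<nu>. \<nu> \<in> V \<Longrightarrow> AE x in \<mu> \<nu>. w \<nu> x \<in> \<real> \<and> 0 < Re (w \<nu> x)"
    and D_domain: "lin_closed DD"
    and D_linear: "\<And>f g a b. f \<in> DD \<Longrightarrow> g \<in> DD \<Longrightarrow>
          D (\<lambda>x. a * f x + b * g x) = (\<lambda>x. a * D f x + b * D g x)"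
    and w_domain: "\<And>\<nu>. \<nu> \<in> V \<Longrightarrow> w \<nu> \<in> DD"
    \<comment> \<open>$R_\nu = M_\nu^{-1} \circ \partial \circ M_{\nu+\sigma}$: the value \<open>R \<nu> f\<close> is the function
        that multiplication by \<open>w \<nu>\<close> takes to \<open>D (mult_op (w (\<nu> + \<sigma>)) f)\<close>. This is an
        identity of functions, not of classes, as \<open>D\<close> need not respect equality almost
        everywhere.\<close>
    and R_conj_domain: "\<And>\<nu> f. \<nu> \<in> V \<Longrightarrow> f \<in> RD \<nu> \<Longrightarrow> mult_op (w (\<nu> + \<sigma>)) f \<in> DD"
    and R_conj: "\<And>\<nu> f. \<nu> \<in> V \<Longrightarrow> f \<in> RD \<nu> \<Longrightarrow>
          mult_op (w \<nu>) (R \<nu> f) = D (mult_op (w (\<nu> + \<sigma>)) f)"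
    and eta_invertible: "bij_betw \<eta> E E'"
    and eta_domain: "\<And>f g. f \<in> E \<Longrightarrow> g \<in> E \<Longrightarrow> (\<lambda>x. f x * g x) \<in> E"
    and eta_mult: "\<And>f g. f \<in> E \<Longrightarrow> g \<in> E \<Longrightarrow> \<eta> (\<lambda>x. f x * g x) = (\<lambda>x. \<eta> f x * \<eta> g x)"
    and eta_poly: "\<And>k p. poly_fun p \<in> pow_dom \<eta> E k"
    and leibniz_w_poly: "\<And>\<nu> n p. \<nu> \<in> V \<Longrightarrow>
          leibniz_defined DD D E \<eta> TD n (w (\<nu> + real n *\<^sub>R \<sigma>)) (poly_fun p)"
    and leibniz: "\<And>n f g x. leibniz_defined DD D E \<eta> TD n f g \<Longrightarrow>
          (D ^^ n) (\<lambda>x. f x * g x) x =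
          (\<Sum>k\<le>n. \<alpha> n k * (\<eta> ^^ k) ((D ^^ (n - k)) f) x * T k n g x)"

end

theory Submission
  imports Defs
begin

text \<open>
  Since $R_\nu = M_\nu^{-1} \circ \partial \circ M_{\nu+\sigma}$, a product of successive raising
  operators telescopes: $R_\nu R_{\nu+\sigma} \cdots R_{\nu+(n-1)\sigma}
  = M_\nu^{-1} \circ \partial^n \circ M_{\nu+n\sigma}$. Applied to $p^{(\nu+n\sigma)}_m$ this gives
  $w_\nu\, p^{(\nu)}_{n+m} = \partial^n (w_{\nu+n\sigma}\, p^{(\nu+n\sigma)}_m)$
  (\<open>weight_times_p_fun_add\<close>), a Rodrigues formula.

  The Leibniz rule expands the right-hand side into terms that contain
  $\eta^k(\partial^{n-k} w_{\nu+n\sigma})$. The Rodrigues formula, now read from right to left, with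
  $m = 0$, at $\nu + k\sigma$ and with $n - k$ steps, identifies
  $\partial^{n-k} w_{\nu+n\sigma} = w_{\nu+k\sigma}\, p^{(\nu+k\sigma)}_{n-k}$
  (\<open>funpow_D_weight\<close>). As $\eta^k$ is multiplicative, it splits this product into the two
  $\eta^k$-factors of the claim, and division by $w_\nu(x)$ finishes the proof.
\<close>

context raising_operators
begin

lemma p_fun_is_poly_fun:
  assumes "\<nu> \<in> V"
  shows "\<exists>p. p \<noteq> 0 \<and> p_fun R \<sigma> n \<nu> = poly_fun p"
  using assms
proof (induction n arbitrary: \<nu>)
  case 0
  have "p_fun R \<sigma> 0 \<nu> = poly_fun 1" by (simp add: poly_fun_def)
  then show ?case by (intro exI[of _ 1]) simp
next
  case (Suc n)
  have "\<nu> + \<sigma> \<in> V" using V_shift[OF Suc.prems, of 1] by simp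
  with Suc.IH obtain p where "p \<noteq> 0" and p: "p_fun R \<sigma> n (\<nu> + \<sigma>) = poly_fun p" by blast
  with R_raises[OF Suc.prems] obtain q
    where "degree q = degree p + 1" "R \<nu> (poly_fun p) = poly_fun q" by blast
  moreover from this have "q \<noteq> 0" by auto
  ultimately show ?case using p by auto
qed

text \<open>
  In \<open>R \<nu> \<circ> R (\<nu> + \<sigma>)\<close> the multiplication by $w_{\nu+\sigma}$ that enters \<open>R \<nu>\<close> cancels the
  division by $w_{\nu+\sigma}$ that ends \<open>R (\<nu> + \<sigma>)\<close>; stated with the weights multiplied
  out, this holds at every point, zeros of the weights included.
\<close>

lemma weight_times_p_fun_add:
  assumes "\<nu> \<in> V"
  shows "mult_op (w \<nu>) (p_fun R \<sigma> (n + m) \<nu>) =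
    (D ^^ n) (mult_op (w (\<nu> + real n *\<^sub>R \<sigma>)) (p_fun R \<sigma> m (\<nu> + real n *\<^sub>R \<sigma>)))"
  using assms
proof (induction n arbitrary: \<nu>)
  case 0
  then show ?case by simp
next
  case (Suc n)
  have V: "\<nu> + \<sigma> \<in> V" using V_shift[OF Suc.prems, of 1] by simp
  have shift: "\<nu> + real (Suc n) *\<^sub>R \<sigma> = \<nu> + \<sigma> + real n *\<^sub>R \<sigma>"
    by (simp add: algebra_simps)
  have RD: "p_fun R \<sigma> (n + m) (\<nu> + \<sigma>) \<in> RD \<nu>"
    using p_fun_is_poly_fun[OF V] poly_RD[OF Suc.prems] by metis
  show ?case
    unfolding shift using R_conj[OF Suc.prems RD] Suc.IH[OF V] by simp
qed

lemma funpow_D_weight: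
  assumes "\<nu> \<in> V"
  shows "(D ^^ n) (w (\<nu> + real n *\<^sub>R \<sigma>)) = mult_op (w \<nu>) (p_fun R \<sigma> n \<nu>)"
  using weight_times_p_fun_add[OF assms, of n 0] by (simp add: mult_op_def)

lemma funpow_eta_mult:
  assumes "f \<in> pow_dom \<eta> E k" and "g \<in> pow_dom \<eta> E k"
  shows "(\<eta> ^^ k) (mult_op f g) = mult_op ((\<eta> ^^ k) f) ((\<eta> ^^ k) g)"
  using assms
proof (induction k)
  case 0
  then show ?case by simp
next
  case (Suc k)
  have "f \<in> pow_dom \<eta> E k" "g \<in> pow_dom \<eta> E k"
    using Suc.prems by (auto simp: pow_dom_def)
  moreover have "(\<eta> ^^ k) f \<in> E" "(\<eta> ^^ k) g \<in> E"
    using Suc.prems by (auto simp: pow_dom_def)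
  ultimately show ?case using Suc.IH eta_mult by (simp add: mult_op_def)
qed

text \<open>
  The last term, with $k = n$, of the Leibniz rule of order $n$ for $w_{\nu+n\sigma}$ contains
  $\eta^n w_{\nu+n\sigma}$, with no $\partial$ applied first.
\<close>

lemma weight_in_pow_dom_eta:
  assumes "\<nu> \<in> V"
  shows "w (\<nu> + real k *\<^sub>R \<sigma>) \<in> pow_dom \<eta> E k"
  using leibniz_w_poly[OF assms, of k 0] unfolding leibniz_defined_def by fastforce

lemma weight_times_p_fun_add_expansion:
  assumes "\<nu> \<in> V"
  shows "w \<nu> x * p_fun R \<sigma> (n + m) \<nu> x =
    (\<Sum>k\<le>n. \<alpha> n k * ((\<eta> ^^ k) (w (\<nu> + real k *\<^sub>R \<sigma>)) x
        * (\<eta> ^^ k) (p_fun R \<sigma> (n - k) (\<nu> + real k *\<^sub>R \<sigma>)) x)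
        * T k n (p_fun R \<sigma> m (\<nu> + real n *\<^sub>R \<sigma>)) x)"
proof -
  let ?W = "w (\<nu> + real n *\<^sub>R \<sigma>)" and ?p = "p_fun R \<sigma> m (\<nu> + real n *\<^sub>R \<sigma>)"
  have eta_split: "(\<eta> ^^ k) ((D ^^ (n - k)) ?W) x =
      (\<eta> ^^ k) (w (\<nu> + real k *\<^sub>R \<sigma>)) x * (\<eta> ^^ k) (p_fun R \<sigma> (n - k) (\<nu> + real k *\<^sub>R \<sigma>)) x"
    if "k \<le> n" for k
  proof -
    have V: "\<nu> + real k *\<^sub>R \<sigma> \<in> V" using V_shift[OF assms] .
    have shift: "\<nu> + real n *\<^sub>R \<sigma> = \<nu> + real k *\<^sub>R \<sigma> + real (n - k) *\<^sub>R \<sigma>"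
      using that by (simp add: of_nat_diff algebra_simps)
    have "p_fun R \<sigma> (n - k) (\<nu> + real k *\<^sub>R \<sigma>) \<in> pow_dom \<eta> E k"
      using p_fun_is_poly_fun[OF V] eta_poly by metis
    then show ?thesis
      unfolding shift funpow_D_weight[OF V]
      using funpow_eta_mult[OF weight_in_pow_dom_eta[OF assms]] by (simp add: mult_op_def)
  qed
  have "leibniz_defined DD D E \<eta> TD n ?W ?p"
    using p_fun_is_poly_fun[OF V_shift[OF assms]] leibniz_w_poly[OF assms] by metis
  then have "(D ^^ n) (mult_op ?W ?p) x =
      (\<Sum>k\<le>n. \<alpha> n k * (\<eta> ^^ k) ((D ^^ (n - k)) ?W) x * T k n ?p x)"
    unfolding mult_op_def by (rule leibniz)
  moreover have "w \<nu> x * p_fun R \<sigma> (n + m) \<nu> x = (D ^^ n) (mult_op ?W ?p) x"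
    using weight_times_p_fun_add[OF assms, of n m] by (metis mult_op_def)
  ultimately show ?thesis by (simp add: eta_split)
qed

end

theorem corollary2p2:
  fixes V :: "(real ^ 'd) set"
    and \<sigma> \<nu> :: "real ^ 'd"
    and \<mu> :: "real ^ 'd \<Rightarrow> real measure"
    and RD :: "real ^ 'd \<Rightarrow> cfun set"
    and R :: "real ^ 'd \<Rightarrow> cfun \<Rightarrow> cfun"
    and w :: "real ^ 'd \<Rightarrow> cfun"
    and DD E E' :: "cfun set"
    and D \<eta> :: "cfun \<Rightarrow> cfun"
    and TD :: "nat \<Rightarrow> nat \<Rightarrow> cfun set"
    and T :: "nat \<Rightarrow> nat \<Rightarrow> cfun \<Rightarrow> cfun"
    and \<alpha> :: "nat \<Rightarrow> nat \<Rightarrow> complex"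
    and n m :: nat
  assumes "raising_operators V \<sigma> \<mu> RD R w DD D E E' \<eta> TD T \<alpha>"
    and "\<nu> \<in> V"
  shows "\<forall>x. w \<nu> x \<noteq> 0 \<longrightarrow>
    p_fun R \<sigma> (n + m) \<nu> x =
    (\<Sum>k\<le>n. \<alpha> n k * ((\<eta> ^^ k) (w (\<nu> + real k *\<^sub>R \<sigma>)) x / w \<nu> x)
        * (\<eta> ^^ k) (p_fun R \<sigma> (n - k) (\<nu> + real k *\<^sub>R \<sigma>)) x
        * T k n (p_fun R \<sigma> m (\<nu> + real n *\<^sub>R \<sigma>)) x)"
proof (intro allI impI)
  fix x
  assume w: "w \<nu> x \<noteq> 0"
  interpret raising_operators V \<sigma> \<mu> RD R w DD D E E' \<eta> TD T \<alpha> by fact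
  have "p_fun R \<sigma> (n + m) \<nu> x = w \<nu> x * p_fun R \<sigma> (n + m) \<nu> x / w \<nu> x"
    using w by simp
  also have "\<dots> = (\<Sum>k\<le>n. \<alpha> n k * ((\<eta> ^^ k) (w (\<nu> + real k *\<^sub>R \<sigma>)) x / w \<nu> x)
        * (\<eta> ^^ k) (p_fun R \<sigma> (n - k) (\<nu> + real k *\<^sub>R \<sigma>)) x
        * T k n (p_fun R \<sigma> m (\<nu> + real n *\<^sub>R \<sigma>)) x)"
    unfolding weight_times_p_fun_add_expansion[OF assms(2)] sum_divide_distrib
    by (simp add: mult.assoc)
  finally show "p_fun R \<sigma> (n + m) \<nu> x =
      (\<Sum>k\<le>n. \<alpha> n k * ((\<eta> ^^ k) (w (\<nu> + real k *\<^sub>R \<sigma>)) x / w \<nu> x)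
        * (\<eta> ^^ k) (p_fun R \<sigma> (n - k) (\<nu> + real k *\<^sub>R \<sigma>)) x
        * T k n (p_fun R \<sigma> m (\<nu> + real n *\<^sub>R \<sigma>)) x)" .
qed

end
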